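(* Let $p$ and $q$ be positive coprime integers with $p\geqslant 59\,q$, and let $$Q_{pq}(t)=t^{10}+(2q^2+p^2)(3q^2-2p^2)\,t^8+(q^8+10p^2q^6+4p^4q^4-14p^6q^2+p^8)\,t^6-p^2q^2(q^8-14p^2q^6+4p^4q^4+10p^6q^2+p^8)\,t^4-p^6q^6(q^2+2p^2)(3p^2-2q^2)\,t^2-q^{10}p^{10}.$$ Then the equation $Q_{pq}(t)=0$ has at least one real root $t$ satisfying $$pq+\frac{16q^3}{p}-\frac{5q^4}{p^2}<t<pq+\frac{16q^3}{p}+\frac{5q^4}{p^2}.$$ *)

theory Defs
  imports Complex_Main
begin

definition Q :: "int \<Rightarrow> int \<Rightarrow> real \<Rightarrow> real" where
  "Q a b t = (let p = real_of_int a; q = real_of_int b in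
     t^10
     + (2*q^2 + p^2) * (3*q^2 - 2*p^2) * t^8
     + (q^8 + 10*p^2*q^6 + 4*p^4*q^4 - 14*p^6*q^2 + p^8) * t^6
     - p^2*q^2 * (q^8 - 14*p^2*q^6 + 4*p^4*q^4 + 10*p^6*q^2 + p^8) * t^4
     - p^6*q^6 * (q^2 + 2*p^2) * (3*p^2 - 2*q^2) * t^2
     - q^10*p^10)"

end

theory Submission
  imports Defs
begin

text \<open>
  The polynomial is homogeneous of degree 20 when \<open>t\<close> has weight 2, so with \<open>x = p/q\<close> and
  \<open>t = q\<^sup>2 w / x\<^sup>2\<close> the two end points become \<open>w = x\<^sup>3 + 16 x \<plusminus> 5\<close>. There the polynomial is,
  up to a positive factor, a polynomial in \<open>x\<close> alone, and after the shift \<open>x = y + 20\<close> all its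
  coefficients have one sign. The intermediate value theorem gives the root.
\<close>

text \<open>\<open>Q\<close> for the pair \<open>x\<close>, \<open>1\<close> (with \<open>x\<close>
  now real) at \<open>t = w / x^2\<close>, multiplied by \<open>x^20\<close> to clear
  denominators.\<close>

definition R :: "real \<Rightarrow> real \<Rightarrow> real" where
  "R x w = w^10 + x^4 * (2 + x^2) * (3 - 2*x^2) * w^8
    + x^8 * (1 + 10*x^2 + 4*x^4 - 14*x^6 + x^8) * w^6
    - x^14 * (1 - 14*x^2 + 4*x^4 + 10*x^6 + x^8) * w^4
    - x^22 * (1 + 2*x^2) * (3*x^2 - 2) * w^2 - x^30"

text \<open>At \<open>w = x^3 + 16*x + c\<close> the terms in \<open>x^34\<close> cancel, and the
  value 16 makes those in \<open>x^32\<close> cancel too. The leading term is then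
  \<open>2*c*x^31\<close>, so the sign for large \<open>x\<close> is that of
  \<open>c\<close>.\<close>

lemma R_pos:
  assumes "x \<ge> 20"
  shows "R x (x^3 + 16*x + 5) > 0"
proof -
  define y where "y = x - 20"
  have x: "x = y + 20" and y: "y \<ge> 0"
    using assms by (simp_all add: y_def)
  \<comment> \<open>Taylor expansion at 20 in Horner form: with \<open>y \<ge> 0\<close> every
    nested summand is nonnegative, and the constant term is strictly positive.\<close>
  have "R x (x^3 + 16*x + 5) =
    57914745871997301804194489383697509765625 + y * (101959069669000859171696280761718750000000
    + y * (85177003420689365481626196873779296875000 + y *
    (45181591665172733731235893134387207031250 + y * (17154244236395826711631108308767089843750
    + y * (4977659646779566049967913610604062500000 + y *
    (1150258290750431644767074341069167187500 + y * (217689901355055846409397128069937250000 + y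
    * (34423420873923719525265314579904894375 + y * (4616131212299969948787191185033544000 + y *
    (530845138537401790567205922423516426 + y * (52798662726817800535715351561302030 + y *
    (4571467673341661223562264556557786 + y * (346233212079657396488675650704060 + y *
    (23018326092832454849666517419528 + y * (1346383689651501763149439022860 + y *
    (69372333523572044660133454209 + y * (3149314493494651539139716700 + y *
    (125865821066169455147846380 + y * (4420306736891056962315870 + y *
    (136000046022571297779385 + y * (3649923417596345665200 + y * (84941119113183187162 + y *
    (1700669685128212570 + y * (28990587780806790 + y * (414936103026360 + y * (4892905202244 +
    y * (46286356460 + y * (337703393 + y * (1783880 + y * (6072 + y *
    (10)))))))))))))))))))))))))))))))"
    unfolding R_def x by algebra
  also have "\<dots> > 0"
    by (intro add_pos_nonneg add_nonneg_nonneg mult_nonneg_nonneg y) simp_all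
  finally show ?thesis
    by simp
qed

lemma R_neg:
  assumes "x \<ge> 20"
  shows "R x (x^3 + 16*x - 5) < 0"
proof -
  define y where "y = x - 20"
  have x: "x = y + 20" and y: "y \<ge> 0"
    using assms by (simp_all add: y_def)
  \<comment> \<open>Here \<open>c = -5\<close> gives the leading coefficient -10; negating turns all
    the coefficients positive.\<close>
  have "- R x (x^3 + 16*x - 5) =
    446476907188545753403094171311667490234375 + y * (672210782993929735147212102239928750000000
    + y * (489923792803361786155767781218831046875000 + y *
    (230209864491779546255789759221104032031250 + y * (78365882449901499144027647343102350156250
    + y * (20587873370092241584516141679513572700000 + y *
    (4342190132557800358523336347951441212500 + y * (755108168071554077127807680949988970000 + y
    * (110349431003470620711414982316469873625 + y * (13742768382586163950423447220668333600 + y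
    * (1473982232157255122630437715569735174 + y * (137242216457298303245662480351164750 + y *
    (11160288021080481784134119356676614 + y * (796142332308872627593604069688380 + y *
    (49980657333931059672691768168472 + y * (2766834441649572218893244329100 + y *
    (135194181694859155122785997791 + y * (5830695797114532387483555100 + y *
    (221735129167230802018374820 + y * (7420173738668089191287870 + y *
    (217810284496262037593415 + y * (5583150776929511858640 + y * (124219365985517913238 + y *
    (2379750197588894170 + y * (38843745662673210 + y * (532674146676600 + y * (6021163368156 +
    y * (54622524300 + y * (382285407 + y * (1937480 + y * (6328 + y *
    (10)))))))))))))))))))))))))))))))"
    unfolding R_def x by algebra
  also have "\<dots> > 0"
    by (intro add_pos_nonneg add_nonneg_nonneg mult_nonneg_nonneg y) simp_all
  finally show ?thesis
    by simp
qed

lemma Q_eq_R: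
  assumes "x > 0" "real_of_int p = x * real_of_int q"
  shows "Q p q (real_of_int q ^ 2 * w / x^2) = (real_of_int q / x) ^ 20 * R x w"
proof -
  \<comment> \<open>In terms of \<open>s\<close>, and after multiplication by \<open>x^20\<close>,
    the claim is a polynomial identity without division.\<close>
  define s where "s = w / x^2"
  have "x ^ 20 * Q p q (real_of_int q ^ 2 * s) = real_of_int q ^ 20 * R x (x^2 * s)"
    unfolding Q_def R_def Let_def assms(2) by algebra
  then show ?thesis
    using assms(1) by (simp add: s_def field_simps)
qed

theorem theorem4p1:
  fixes p q :: int
  assumes "0 < p" and "0 < q" and "coprime p q" and "p \<ge> 59 * q"
  shows "\<exists>t::real. Q p q t = 0
    \<and> real_of_int p * real_of_int q + 16 * real_of_int q ^ 3 / real_of_int p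
        - 5 * real_of_int q ^ 4 / real_of_int p ^ 2 < t
    \<and> t < real_of_int p * real_of_int q + 16 * real_of_int q ^ 3 / real_of_int p
        + 5 * real_of_int q ^ 4 / real_of_int p ^ 2"
proof -
  define x where "x = real_of_int p / real_of_int q"
  have q: "real_of_int q > 0" and pq: "real_of_int p = x * real_of_int q"
    using assms(2) by (simp_all add: x_def)
  have "real_of_int p \<ge> 59 * real_of_int q"
    using assms(4) by linarith
  then have x: "x \<ge> 59"
    using q by (simp add: x_def field_simps)
  define a where "a = real_of_int q ^ 2 * (x^3 + 16*x - 5) / x^2"
  define b where "b = real_of_int q ^ 2 * (x^3 + 16*x + 5) / x^2"
  have a: "a = real_of_int p * real_of_int q + 16 * real_of_int q ^ 3 / real_of_int p
      - 5 * real_of_int q ^ 4 / real_of_int p ^ 2"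
    and b: "b = real_of_int p * real_of_int q + 16 * real_of_int q ^ 3 / real_of_int p
      + 5 * real_of_int q ^ 4 / real_of_int p ^ 2"
    unfolding a_def b_def pq using q x by (simp_all add: field_simps eval_nat_numeral)
  have "a \<le> b"
    unfolding a_def b_def using x by (intro divide_right_mono mult_left_mono) simp_all
  \<comment> \<open>The factor \<open>(q/x)^20\<close> is positive, so \<open>Q\<close> inherits the
    sign of \<open>R\<close>.\<close>
  have Qa: "Q p q a < 0"
    unfolding a_def using assms(2) x pq R_neg[of x]
    by (subst Q_eq_R) (simp_all add: mult_pos_neg)
  have Qb: "0 < Q p q b"
    unfolding b_def using assms(2) x pq R_pos[of x]
    by (subst Q_eq_R) simp_all
  have "continuous_on {a..b} (Q p q)"
    unfolding Q_def Let_def by (intro continuous_intros)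
  then obtain t where "a \<le> t" "t \<le> b" "Q p q t = 0"
    using IVT'[of "Q p q" a 0 b] Qa Qb \<open>a \<le> b\<close> by auto
  \<comment> \<open>The intermediate value theorem places \<open>t\<close> in the closed interval;
    the nonzero values at the end points make both bounds strict.\<close>
  moreover have "t \<noteq> a" "t \<noteq> b"
    using Qa Qb \<open>Q p q t = 0\<close> by auto
  ultimately show ?thesis
    unfolding a[symmetric] b[symmetric] by (intro exI[of _ t]) simp
qed

end
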